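(* Let $\Gamma$ and $\Sigma$ be two finite connected simple graphs with $m$ and $n$ vertices, respectively, having the same Euler characteristic, and suppose $m \leq n$. Then: (1) there is a finite sequence of moves, each of which is an expanding operation of type (i) or (ii) or an edge slide, which transforms $\Gamma$ into a graph isomorphic to $\Sigma$; (2) there is a finite sequence of moves, each of which is a collapsing operation of type (iii) or (iv) or an edge slide, which transforms $\Sigma$ into a graph isomorphic to $\Gamma$.
   Context: A simple graph has no loops and no double edges; write $x \sim y$ if the vertices $x,y$ are joined by an edge $\overline{xy}$, and $d(x)$ for the degree of $x$. The Euler characteristic of a finite graph is $\chi = (\text{number of vertices}) - (\text{number of edges})$. An (edge) slide on a graph $(V,E)$: given three distinct vertices $x,y,z \in V$ with $x \sim y \sim z$ and $x \not\sim z$, replace the edge $\overline{xy}$ by the edge $\overline{xz}$, so that the new graph is $(V, (E \setminus \{\overline{xy}\}) \cup \{\overline{xz}\})$. Expanding operations: (i) add a new vertex $y$ which is attached to any given vertex $x$ by a new edge $\overline{xy}$ (so that $d(y)=1$); (ii) for any edge $\overline{xz}$, add a new vertex $y$ to its interior, i.e. delete the edge $\overline{xz}$ and add the new vertex $y$ and the two edges $\overline{zy}$ and $\overline{yx}$. Collapsing operations: (iii) if $y$ is a vertex with $d(y)=1$, delete $y$ and the edge that joins it to the rest of the graph; (iv) if $y$ is a vertex with $d(y)=2$ whose two distinct neighbours $x$ and $z$ satisfy $x \not\sim z$, delete $y$ together with the edges $\overline{zy}$ and $\overline{yx}$ and add the edge $\overline{zx}$. Sequences of moves may be empty. *)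

theory Defs
  imports "Graph_Theory.Graph_Theory"
begin

text \<open>
  Finite simple graphs are rendered by the locale \<open>pair_graph\<close> of the entry Graph_Theory: finite
  vertex set, symmetric loopless arc relation. An undirected edge joining \<open>x\<close> and \<open>y\<close> is the pair of
  arcs \<open>(x, y)\<close>, \<open>(y, x)\<close>, so every move below adds or removes both of them. In such a graph the
  degree of a vertex is its \<open>out_degree\<close>.
\<close>

definition edge_set :: "'a pair_pre_digraph \<Rightarrow> 'a set set" where
  "edge_set G = {{x, y} |x y. (x, y) \<in> parcs G}"

definition euler_char :: "'a pair_pre_digraph \<Rightarrow> int" where
  "euler_char G = int (card (pverts G)) - int (card (edge_set G))"

inductive edge_slide :: "'a pair_pre_digraph \<Rightarrow> 'a pair_pre_digraph \<Rightarrow> bool" where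
  slide: "\<lbrakk> x \<in> pverts G; y \<in> pverts G; z \<in> pverts G; x \<noteq> y; y \<noteq> z; x \<noteq> z;
            (x, y) \<in> parcs G; (y, z) \<in> parcs G; (x, z) \<notin> parcs G \<rbrakk>
    \<Longrightarrow> edge_slide G \<lparr> pverts = pverts G,
                       parcs = (parcs G - {(x, y), (y, x)}) \<union> {(x, z), (z, x)} \<rparr>"

inductive expansion :: "'a pair_pre_digraph \<Rightarrow> 'a pair_pre_digraph \<Rightarrow> bool" where
  add_leaf: "\<lbrakk> x \<in> pverts G; y \<notin> pverts G \<rbrakk>
    \<Longrightarrow> expansion G \<lparr> pverts = pverts G \<union> {y}, parcs = parcs G \<union> {(x, y), (y, x)} \<rparr>"
| subdivide_edge: "\<lbrakk> (x, z) \<in> parcs G; y \<notin> pverts G \<rbrakk> \<Longrightarrow> expansion G (subdivide G (x, z) y)"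

inductive collapse :: "'a pair_pre_digraph \<Rightarrow> 'a pair_pre_digraph \<Rightarrow> bool" where
  delete_leaf: "\<lbrakk> y \<in> pverts G; out_degree (with_proj G) y = 1; (y, x) \<in> parcs G \<rbrakk>
    \<Longrightarrow> collapse G \<lparr> pverts = pverts G - {y}, parcs = parcs G - {(x, y), (y, x)} \<rparr>"
| smooth_vertex: "\<lbrakk> y \<in> pverts G; out_degree (with_proj G) y = 2;
                    (y, x) \<in> parcs G; (y, z) \<in> parcs G; x \<noteq> z; (x, z) \<notin> parcs G \<rbrakk>
    \<Longrightarrow> collapse G \<lparr> pverts = pverts G - {y},
                     parcs = (parcs G - {(z, y), (y, z), (y, x), (x, y)}) \<union> {(z, x), (x, z)} \<rparr>"

text \<open>
  The type \<open>'a\<close> may be finite and fully used up by the vertices of \<open>G\<close>, and an expansion needs a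
  vertex outside \<open>G\<close>. The following is the same graph \<open>G\<close>, with its vertices tagged by \<open>Inl\<close>, in a
  type that always provides the unused vertices \<open>Inr 0, Inr 1, \<dots>\<close>.
\<close>

definition with_fresh_vertices :: "'a pair_pre_digraph \<Rightarrow> ('a + nat) pair_pre_digraph" where
  "with_fresh_vertices G = \<lparr> pverts = Inl ` pverts G, parcs = map_prod Inl Inl ` parcs G \<rparr>"

end

theory Submission
  imports Defs
begin

text \<open>
  Slides preserve the vertex set, the number of edges and connectedness, and they are reversible. Fix
  a vertex \<open>c\<close> of a connected graph. A vertex at distance two from \<open>c\<close> can be joined to \<open>c\<close> by a slide,
  so slides lead to a cone with apex \<open>c\<close>. In a cone the apex serves as a relay:
  \<open>xc\<close> slides to \<open>xz\<close>, and then \<open>xy\<close> slides to \<open>xc\<close>, so that in effect an arbitrary edge \<open>xy\<close> off the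
  apex is replaced by an arbitrary non-edge \<open>xz\<close>. Hence any two connected graphs on the same vertex set
  with equally many edges are related by slides. In (1), attach \<open>n - m\<close> leaves to \<open>\<Gamma>\<close> and then slide to
  a copy of \<open>\<Sigma>\<close>; in (2), slide \<open>\<Sigma>\<close> to a copy of \<open>\<Gamma>\<close> with \<open>n - m\<close> leaves attached and then delete these.
\<close>

section \<open>Simple graphs and connectedness as statements about the arc relation\<close>

text \<open>Turns the locale into plain facts about a relation, so that graphs built explicitly can
  be checked by \<open>auto\<close>. Finiteness of the arc set follows from that of the vertex
  set.\<close>

lemma pair_graph_iff:
  "pair_graph G \<longleftrightarrow> finite (pverts G) \<and> parcs G \<subseteq> pverts G \<times> pverts G \<and> sym (parcs G) \<and> irrefl (parcs G)"
proof
  assume "pair_graph G"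
  then interpret pair_graph G .
  show "finite (pverts G) \<and> parcs G \<subseteq> pverts G \<times> pverts G \<and> sym (parcs G) \<and> irrefl (parcs G)"
    using pair_finite_verts arc_fst_in_verts arc_snd_in_verts pair_no_loops arcs_symmetric
    by (fastforce intro!: symI irreflI)
next
  assume *: "finite (pverts G) \<and> parcs G \<subseteq> pverts G \<times> pverts G \<and> sym (parcs G) \<and> irrefl (parcs G)"
  then have "finite (parcs G)"
    by (meson finite_SigmaI finite_subset)
  with * show "pair_graph G"
    by unfold_locales (auto simp: symmetric_def irrefl_def)
qed

text \<open>Arcs are symmetric, so directed reachability captures undirected connectedness, and
  \<open>rtrancl\<close> supplies induction and monotonicity. Nonemptiness provides an apex for
  cones and a vertex to carry leaves.\<close>

definition connected_pair_graph :: "'a pair_pre_digraph \<Rightarrow> bool" where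
  "connected_pair_graph G \<longleftrightarrow> pair_graph G \<and> pverts G \<noteq> {}
    \<and> (\<forall>u\<in>pverts G. \<forall>v\<in>pverts G. (u, v) \<in> (parcs G)\<^sup>*)"

lemma connected_pair_graphI:
  assumes "pair_graph G" and "connected (with_proj G)"
  shows "connected_pair_graph G"
proof -
  interpret pair_graph G by fact
  have "strongly_connected (with_proj G)"
    using assms(2) pair_sym_arcs by (rule symmetric_connected_imp_strongly_connected[rotated])
  then show ?thesis
    using assms(1) reachable_rtranclI
    by (auto simp: connected_pair_graph_def strongly_connected_def reachable_def
             dest!: rtrancl_on_rtranclI)
qed

text \<open>The map from arcs to undirected edges has fibres of size exactly two, since there are no
  loops. This translates Euler characteristics into arc counts, which the slide arguments use
  throughout.\<close>

lemma card_parcs: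
  assumes "pair_graph G"
  shows "card (parcs G) = 2 * card (edge_set G)"
proof -
  interpret pair_graph G by fact
  let ?g = "\<lambda>(x, y). {x, y}"
  have e: "edge_set G = ?g ` parcs G"
    by (auto simp: edge_set_def image_def)
  have two: "card {a \<in> parcs G. ?g a = e} = 2" if edge: "e \<in> edge_set G" for e
  proof -
    obtain x y where xy: "(x, y) \<in> parcs G" "e = {x, y}"
      using edge by (auto simp: edge_set_def)
    have "(y, x) \<in> parcs G"
      using xy arcs_symmetric by simp
    have "a \<in> parcs G \<and> ?g a = e \<longleftrightarrow> a = (x, y) \<or> a = (y, x)" for a
      using xy \<open>(y, x) \<in> parcs G\<close> by (cases a) (simp add: doubleton_eq_iff, blast)
    then have "{a \<in> parcs G. ?g a = e} = {(x, y), (y, x)}"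
      by simp blast
    moreover have "x \<noteq> y"
      using xy pair_no_loops by fastforce
    ultimately show ?thesis by simp
  qed
  have "card (parcs G) = (\<Sum>e\<in>?g ` parcs G. \<Sum>a\<in>{a \<in> parcs G. ?g a = e}. 1)"
    using sum.image_gen[OF pair_finite_arcs, of "\<lambda>_. 1::nat" ?g] by simp
  also have "\<dots> = (\<Sum>e\<in>edge_set G. 2)"
    unfolding e[symmetric] by (rule sum.cong) (auto simp: two)
  finally show ?thesis by simp
qed

lemma rtranclp_trans_mono:
  assumes "R\<^sup>*\<^sup>* x y" "S\<^sup>*\<^sup>* y z" "R \<le> T" "S \<le> T"
  shows "T\<^sup>*\<^sup>* x z"
  using assms rtranclp_mono by (meson predicate2D rtranclp_trans)

section \<open>Slides with a fixed vertex set\<close>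

text \<open>A slide is the case where the old and the new edge share an endpoint. Allowing four
  vertices also expresses the net effect of several slides.\<close>

definition replace_edge :: "'a pair_pre_digraph \<Rightarrow> 'a \<Rightarrow> 'a \<Rightarrow> 'a \<Rightarrow> 'a \<Rightarrow> 'a pair_pre_digraph" where
  "replace_edge G x y z w =
    \<lparr> pverts = pverts G, parcs = (parcs G - {(x, y), (y, x)}) \<union> {(z, w), (w, z)} \<rparr>"

lemma replace_edge_simps [simp]:
  "pverts (replace_edge G x y z w) = pverts G"
  "parcs (replace_edge G x y z w) = (parcs G - {(x, y), (y, x)}) \<union> {(z, w), (w, z)}"
  by (simp_all add: replace_edge_def)

lemma pair_graph_replace_edge:
  assumes "pair_graph G" "z \<in> pverts G" "w \<in> pverts G" "z \<noteq> w"
  shows "pair_graph (replace_edge G x y z w)"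
  using assms unfolding pair_graph_iff by (auto simp: sym_def irrefl_def)

lemma card_parcs_replace_edge:
  assumes "pair_graph G" "(x, y) \<in> parcs G" "(z, w) \<notin> parcs G" "z \<noteq> w"
  shows "card (parcs (replace_edge G x y z w)) = card (parcs G)"
proof -
  interpret pair_graph G by fact
  have "x \<noteq> y" "(y, x) \<in> parcs G" "(w, z) \<notin> parcs G"
    using assms arcs_symmetric no_loops' by blast+
  then have "card (parcs G - {(x, y), (y, x)}) + 2 = card (parcs G)"
    using assms card_mono[OF pair_finite_arcs, of "{(x, y), (y, x)}"]
    by (simp add: card_Diff_subset)
  moreover have "card (parcs G - {(x, y), (y, x)} \<union> {(z, w), (w, z)})
      = card (parcs G - {(x, y), (y, x)}) + card {(z, w), (w, z)}"
    using assms \<open>(w, z) \<notin> parcs G\<close> pair_finite_arcs by (intro card_Un_disjoint) auto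
  ultimately show ?thesis
    using assms by simp
qed

lemma edge_slideE:
  assumes "edge_slide G H" "pair_graph G"
  obtains x y z where "H = replace_edge G x y x z" "x \<in> pverts G" "y \<in> pverts G" "z \<in> pverts G"
    "x \<noteq> y" "y \<noteq> z" "x \<noteq> z" "(x, y) \<in> parcs G" "(y, z) \<in> parcs G" "(x, z) \<notin> parcs G"
    "(y, x) \<in> parcs G" "(z, y) \<in> parcs G" "(z, x) \<notin> parcs G"
proof -
  interpret pair_graph G by fact
  show ?thesis
    using assms(1) that arcs_symmetric by cases (metis replace_edge_def)
qed

lemma edge_slideI:
  assumes "pair_graph G" "(x, y) \<in> parcs G" "(y, z) \<in> parcs G" "(x, z) \<notin> parcs G" "x \<noteq> z"
  shows "edge_slide G (replace_edge G x y x z)"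
proof -
  interpret pair_graph G by fact
  show ?thesis
    unfolding replace_edge_def using assms in_arcsD1 in_arcsD2 no_loops'
    by (intro edge_slide.slide) blast+
qed

lemma edge_slide_pair_graph:
  assumes "edge_slide G H" "pair_graph G"
  shows "pair_graph H \<and> pverts H = pverts G \<and> card (parcs H) = card (parcs G)"
  using assms
  by (elim edge_slideE) (auto simp del: replace_edge_simps(2)
      simp: card_parcs_replace_edge intro!: pair_graph_replace_edge)

lemma edge_slides_pair_graph:
  assumes "edge_slide\<^sup>*\<^sup>* G H" "pair_graph G"
  shows "pair_graph H \<and> pverts H = pverts G \<and> card (parcs H) = card (parcs G)"
  using assms by (induction rule: rtranclp_induct) (auto dest: edge_slide_pair_graph)

text \<open>After \<open>xy\<close> has slid to \<open>xz\<close> along \<open>yz\<close>, the edge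
  \<open>yz\<close> is still present and \<open>xy\<close> is absent, so \<open>xz\<close> can slide
  back along \<open>zy\<close>.\<close>

lemma edge_slide_sym:
  assumes "edge_slide G H" "pair_graph G"
  shows "edge_slide H G"
  using assms
proof (rule edge_slideE)
  fix x y z
  assume *: "H = replace_edge G x y x z" "x \<in> pverts G" "y \<in> pverts G" "z \<in> pverts G"
    "x \<noteq> y" "y \<noteq> z" "x \<noteq> z" "(x, y) \<in> parcs G" "(y, z) \<in> parcs G" "(x, z) \<notin> parcs G"
    "(y, x) \<in> parcs G" "(z, y) \<in> parcs G" "(z, x) \<notin> parcs G"
  have "edge_slide H (replace_edge H x z x y)"
    using * edge_slide_pair_graph[OF assms] by (intro edge_slideI) auto
  moreover have "replace_edge H x z x y = G"
    using * by (intro pair_pre_digraph.equality) auto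
  ultimately show ?thesis by simp
qed

lemma edge_slides_sym:
  assumes "edge_slide\<^sup>*\<^sup>* G H" "pair_graph G"
  shows "edge_slide\<^sup>*\<^sup>* H G"
  using assms
proof (induction rule: rtranclp_induct)
  case (step H K)
  then have "edge_slide K H"
    using edge_slide_sym edge_slides_pair_graph by metis
  with step show ?case
    by (simp add: converse_rtranclp_into_rtranclp)
qed simp

text \<open>The only lost edge \<open>xy\<close> is bypassed by the path through \<open>z\<close>,
  so every old path can be rerouted.\<close>

lemma edge_slide_connected:
  assumes "edge_slide G H" "connected_pair_graph G"
  shows "connected_pair_graph H"
proof -
  have G: "pair_graph G"
    using assms by (simp add: connected_pair_graph_def)
  with assms(1) show ?thesis
  proof (rule edge_slideE)
    fix x y z
    assume *: "H = replace_edge G x y x z" "x \<in> pverts G" "y \<in> pverts G" "z \<in> pverts G"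
      "x \<noteq> y" "y \<noteq> z" "x \<noteq> z" "(x, y) \<in> parcs G" "(y, z) \<in> parcs G" "(x, z) \<notin> parcs G"
      "(y, x) \<in> parcs G" "(z, y) \<in> parcs G" "(z, x) \<notin> parcs G"
    have path: "(x, z) \<in> parcs H" "(z, y) \<in> parcs H" "(y, z) \<in> parcs H" "(z, x) \<in> parcs H"
      using * by auto
    have "(x, y) \<in> (parcs H)\<^sup>*" "(y, x) \<in> (parcs H)\<^sup>*"
      using path by (meson r_into_rtrancl rtrancl_trans)+
    moreover have "parcs G \<subseteq> parcs H \<union> {(x, y), (y, x)}"
      using * by auto
    ultimately have "parcs G \<subseteq> (parcs H)\<^sup>*"
      by auto
    then have "(parcs G)\<^sup>* \<subseteq> (parcs H)\<^sup>*"
      by (metis rtrancl_idemp rtrancl_mono)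
    then show ?thesis
      using assms edge_slide_pair_graph[OF assms(1) G] by (auto simp: connected_pair_graph_def)
  qed
qed

section \<open>Cones\<close>

definition apex :: "'a pair_pre_digraph \<Rightarrow> 'a \<Rightarrow> bool" where
  "apex G c \<longleftrightarrow> c \<in> pverts G \<and> (\<forall>v\<in>pverts G - {c}. (c, v) \<in> parcs G)"

text \<open>Each slide gives \<open>c\<close> one new neighbour and takes none away, so induction on
  the number of vertices not adjacent to \<open>c\<close> applies.\<close>

lemma edge_slides_to_cone:
  assumes "connected_pair_graph G" "c \<in> pverts G"
  shows "\<exists>H. edge_slide\<^sup>*\<^sup>* G H \<and> apex H c"
  using assms
proof (induction "card (pverts G - parcs G `` {c})" arbitrary: G rule: less_induct)
  case less
  interpret pair_graph G
    using less.prems by (simp add: connected_pair_graph_def)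
  have G: "pair_graph G" ..
  show ?case
  proof (cases "apex G c")
    case False
    let ?N = "insert c (parcs G `` {c})"
    obtain v where v: "v \<in> pverts G" "v \<notin> ?N"
      using False less.prems(2) by (auto simp: apex_def)
    have "(c, v) \<in> (parcs G)\<^sup>*"
      using less.prems v by (simp add: connected_pair_graph_def)
    \<comment> \<open>A path from \<open>c\<close> to \<open>v\<close> starts in the closed
      neighbourhood \<open>?N\<close> and ends outside it, so some arc leaves \<open>?N\<close>. Its
      tail \<open>y\<close> is not \<open>c\<close>, since otherwise its head \<open>x\<close> would
      be a neighbour of \<open>c\<close>; thus \<open>x\<close> has distance two from
      \<open>c\<close>.\<close>
    from this v(2) have "\<exists>y x. (y, x) \<in> parcs G \<and> y \<in> ?N \<and> x \<notin> ?N"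
      by (induction rule: rtrancl_induct) blast+
    then obtain y x where yx: "(y, x) \<in> parcs G" "(c, y) \<in> parcs G" "x \<noteq> c" "(c, x) \<notin> parcs G"
      by auto
    let ?H = "replace_edge G x y x c"
    have s: "edge_slide G ?H"
      using yx arcs_symmetric by (intro edge_slideI[OF G]) blast+
    \<comment> \<open>The removed edge \<open>xy\<close> does not meet \<open>c\<close>, so all
      neighbours of \<open>c\<close> survive and \<open>x\<close> joins them.\<close>
    have "pverts ?H - parcs ?H `` {c} \<subset> pverts G - parcs G `` {c}"
      using yx in_arcsD2 no_loops' by auto
    then have "card (pverts ?H - parcs ?H `` {c}) < card (pverts G - parcs G `` {c})"
      using pair_finite_verts by (meson finite_Diff psubset_card_mono)
    then obtain K where "edge_slide\<^sup>*\<^sup>* ?H K" "apex K c"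
      using less.hyps[OF _ edge_slide_connected[OF s]] less.prems by (metis replace_edge_simps(1))
    then show ?thesis
      using s by (meson converse_rtranclp_into_rtranclp)
  qed blast
qed

lemma apex_replace_edge:
  assumes "apex G c" "x \<noteq> c" "y \<noteq> c"
  shows "apex (replace_edge G x y z w) c"
  using assms by (auto simp: apex_def)

lemma cone_rotate_edge:
  assumes "pair_graph G" "apex G c" "(x, y) \<in> parcs G" "x \<noteq> c" "y \<noteq> c" "z \<noteq> c"
    "z \<in> pverts G" "(x, z) \<notin> parcs G" "x \<noteq> z"
  shows "edge_slide\<^sup>*\<^sup>* G (replace_edge G x y x z)"
proof -
  interpret pair_graph G by fact
  have c: "(x, c) \<in> parcs G" "(c, x) \<in> parcs G" "(c, y) \<in> parcs G" "(c, z) \<in> parcs G"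
    "(y, x) \<in> parcs G" "(y, c) \<in> parcs G" "x \<noteq> y"
  proof -
    have "x \<in> pverts G" "y \<in> pverts G" "x \<noteq> y"
      using assms in_arcsD1 in_arcsD2 no_loops' by blast+
    moreover from this have "(c, x) \<in> parcs G" "(c, y) \<in> parcs G" "(c, z) \<in> parcs G"
      using assms by (auto simp: apex_def)
    ultimately show "(x, c) \<in> parcs G" "(c, x) \<in> parcs G" "(c, y) \<in> parcs G" "(c, z) \<in> parcs G"
      "(y, x) \<in> parcs G" "(y, c) \<in> parcs G" "x \<noteq> y"
      using assms(3) arcs_symmetric by blast+
  qed
  let ?H = "replace_edge G x c x z"
  have 1: "edge_slide G ?H"
    using c assms by (intro edge_slideI) auto
  \<comment> \<open>The first slide has vacated the position \<open>xc\<close>, so \<open>xy\<close>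
    can now move there along \<open>yc\<close>, which restores the spoke.\<close>
  have "edge_slide ?H (replace_edge ?H x y x c)"
    using c assms edge_slide_pair_graph[OF 1] by (intro edge_slideI) auto
  moreover have "replace_edge ?H x y x c = replace_edge G x y x z"
    using c assms by (intro pair_pre_digraph.equality) auto
  ultimately show ?thesis
    using 1 by simp
qed

text \<open>If the two edges share an endpoint, one rotation suffices; otherwise two rotations pass
  through the position \<open>xz\<close>.\<close>

lemma cone_move_edge:
  assumes G: "pair_graph G" and c: "apex G c"
    and xy: "(x, y) \<in> parcs G" "x \<noteq> c" "y \<noteq> c"
    and zw: "z \<in> pverts G" "w \<in> pverts G" "(z, w) \<notin> parcs G" "z \<noteq> w"
  shows "edge_slide\<^sup>*\<^sup>* G (replace_edge G x y z w)"
proof -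
  interpret pair_graph G by fact
  have sym: "(y, x) \<in> parcs G" "(w, z) \<notin> parcs G" "x \<noteq> y" "x \<in> pverts G" "y \<in> pverts G"
    using xy zw arcs_symmetric no_loops' in_arcsD1 in_arcsD2 by blast+
  \<comment> \<open>The apex is adjacent to every other vertex, so a non-edge cannot contain
    it.\<close>
  have czw: "z \<noteq> c" "w \<noteq> c"
    using c zw sym(2) by (auto simp: apex_def)
  note rotate = cone_rotate_edge[OF G c]
  have swap: "replace_edge G x y z w = replace_edge G x y w z"
    "replace_edge G x y z w = replace_edge G y x z w"
    by (auto simp: replace_edge_def)
  consider "x = z" | "x = w" | "y = z" | "y = w" | (new) "x \<notin> {z, w}" "y \<notin> {z, w}"
    by auto
  then show ?thesis
  proof cases
    case new
    \<comment> \<open>If \<open>xz\<close> is free, \<open>xy\<close> moves to \<open>xz\<close> and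
      then on to \<open>zw\<close>. If \<open>xz\<close> is occupied, the order is reversed: the
      edge already there moves to \<open>zw\<close> first, and \<open>xy\<close> then fills the gap.
      Both intermediate graphs are still cones, because no spoke is touched.\<close>
    show ?thesis
    proof (cases "(x, z) \<in> parcs G")
      case False
      let ?H = "replace_edge G x y x z"
      have 1: "edge_slide\<^sup>*\<^sup>* G ?H"
        using xy zw czw new False by (intro rotate) auto
      have "edge_slide\<^sup>*\<^sup>* ?H (replace_edge ?H z x z w)"
        using edge_slides_pair_graph[OF 1 G] apex_replace_edge[OF c] xy zw czw new sym False
        by (intro cone_rotate_edge[of _ c]) auto
      moreover have "replace_edge ?H z x z w = replace_edge G x y z w"
        using new False arcs_symmetric by (intro pair_pre_digraph.equality) auto
      ultimately show ?thesis
        using 1 by simp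
    next
      case True
      let ?H = "replace_edge G z x z w"
      have 1: "edge_slide\<^sup>*\<^sup>* G ?H"
        using xy zw czw new True arcs_symmetric by (intro rotate) auto
      have "edge_slide\<^sup>*\<^sup>* ?H (replace_edge ?H x y x z)"
        using edge_slides_pair_graph[OF 1 G] apex_replace_edge[OF c] xy zw czw new sym True
        by (intro cone_rotate_edge[of _ c]) auto
      moreover have "replace_edge ?H x y x z = replace_edge G x y z w"
        using new True arcs_symmetric by (intro pair_pre_digraph.equality) auto
      ultimately show ?thesis
        using 1 by simp
    qed
  qed (use rotate[of x y w] rotate[of x y z] rotate[of y x w] rotate[of y x z] xy zw czw sym swap
        in \<open>auto simp: replace_edge_def insert_commute\<close>)
qed

text \<open>Trading an edge of \<open>G\<close> outside \<open>H\<close> for an edge of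
  \<open>H\<close> outside \<open>G\<close> lowers the number of arcs of \<open>H\<close> missing
  from \<open>G\<close>.\<close>

lemma edge_slides_between_cones:
  assumes "pair_graph G" "apex G c" "pair_graph H" "apex H c"
    "pverts G = pverts H" "card (parcs G) = card (parcs H)"
  shows "edge_slide\<^sup>*\<^sup>* G H"
  using assms
proof (induction "card (parcs H - parcs G)" arbitrary: G rule: less_induct)
  case less
  interpret G: pair_graph G by fact
  interpret H: pair_graph H by fact
  show ?case
  proof (cases "parcs G = parcs H")
    case True
    then have "G = H"
      using less.prems by (intro pair_pre_digraph.equality) auto
    then show ?thesis by simp
  next
    case False
    \<comment> \<open>Finite sets of equal size that differ cannot be nested, so each of the two arc
      sets has an arc that the other lacks.\<close>
    then obtain x y where xy: "(x, y) \<in> parcs G" "(x, y) \<notin> parcs H"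
      using less.prems(6) G.pair_finite_arcs H.pair_finite_arcs
      by (metis card_subset_eq subrelI)
    obtain z w where zw: "(z, w) \<in> parcs H" "(z, w) \<notin> parcs G"
      using False less.prems(6) G.pair_finite_arcs H.pair_finite_arcs
      by (metis card_subset_eq subrelI)
    have sym: "(y, x) \<notin> parcs H" "z \<noteq> w" "z \<in> pverts G" "w \<in> pverts G" "(w, z) \<in> parcs H"
      using xy zw H.arcs_symmetric H.no_loops' H.in_arcsD1 H.in_arcsD2 less.prems(5) by auto
    \<comment> \<open>All spokes at \<open>c\<close> belong to \<open>H\<close> as well, so an edge
      missing from \<open>H\<close> avoids \<open>c\<close>. Its removal therefore leaves a
      cone.\<close>
    have xyc: "x \<noteq> c" "y \<noteq> c"
      using xy sym(1) G.in_arcsD1 G.in_arcsD2 G.no_loops' H.arcs_symmetric less.prems(4,5)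
      unfolding apex_def by blast+
    let ?K = "replace_edge G x y z w"
    have s: "edge_slide\<^sup>*\<^sup>* G ?K"
      using less.prems xy zw sym xyc by (intro cone_move_edge) auto
    have "parcs H - parcs ?K \<subset> parcs H - parcs G"
      using xy zw sym by auto
    then have "card (parcs H - parcs ?K) < card (parcs H - parcs G)"
      using H.pair_finite_arcs by (meson finite_Diff psubset_card_mono)
    then have "edge_slide\<^sup>*\<^sup>* ?K H"
      using less.prems edge_slides_pair_graph[OF s] apex_replace_edge[OF _ xyc]
      by (intro less.hyps) auto
    with s show ?thesis by simp
  qed
qed

text \<open>Both graphs slide to cones with a common apex; the second sequence of slides is then run
  backwards.\<close>

theorem edge_slides_between_connected:
  assumes "connected_pair_graph G" "connected_pair_graph H"
    "pverts G = pverts H" "card (parcs G) = card (parcs H)"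
  shows "edge_slide\<^sup>*\<^sup>* G H"
proof -
  have pg: "pair_graph G" "pair_graph H"
    using assms by (simp_all add: connected_pair_graph_def)
  obtain c where c: "c \<in> pverts G"
    using assms(1) by (auto simp: connected_pair_graph_def)
  obtain G' H' where G': "edge_slide\<^sup>*\<^sup>* G G'" "apex G' c" and H': "edge_slide\<^sup>*\<^sup>* H H'" "apex H' c"
    using edge_slides_to_cone c assms by metis
  have "edge_slide\<^sup>*\<^sup>* G' H'"
    using edge_slides_pair_graph[OF G'(1) pg(1)] edge_slides_pair_graph[OF H'(1) pg(2)] G' H' assms
    by (intro edge_slides_between_cones) auto
  with G'(1) edge_slides_sym[OF H'(1) pg(2)] show ?thesis by simp
qed

section \<open>Attaching leaves and renaming vertices\<close>

definition attach_leaves :: "'a pair_pre_digraph \<Rightarrow> 'a \<Rightarrow> 'a set \<Rightarrow> 'a pair_pre_digraph" where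
  "attach_leaves G x S = \<lparr> pverts = pverts G \<union> S, parcs = parcs G \<union> {x} \<times> S \<union> S \<times> {x} \<rparr>"

lemma attach_leaves_simps [simp]:
  "pverts (attach_leaves G x S) = pverts G \<union> S"
  "parcs (attach_leaves G x S) = parcs G \<union> {x} \<times> S \<union> S \<times> {x}"
  by (simp_all add: attach_leaves_def)

lemma attach_leaves_empty [simp]: "attach_leaves G x {} = G"
  by (simp add: attach_leaves_def)

text \<open>The vertex \<open>x\<close> serves as a hub: every vertex reaches it and is reached from
  it.\<close>

lemma attach_leaves_connected:
  assumes "connected_pair_graph G" "x \<in> pverts G" "finite S" "S \<inter> pverts G = {}"
  shows "connected_pair_graph (attach_leaves G x S)"
proof -
  let ?H = "attach_leaves G x S"
  have "(u, x) \<in> (parcs ?H)\<^sup>* \<and> (x, u) \<in> (parcs ?H)\<^sup>*" if "u \<in> pverts ?H" for u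
  proof (cases "u \<in> S")
    case False
    then have "(u, x) \<in> (parcs G)\<^sup>*" "(x, u) \<in> (parcs G)\<^sup>*"
      using that assms by (auto simp: connected_pair_graph_def)
    moreover have "(parcs G)\<^sup>* \<subseteq> (parcs ?H)\<^sup>*"
      by (intro rtrancl_mono) auto
    ultimately show ?thesis by blast
  qed auto
  then have "(u, v) \<in> (parcs ?H)\<^sup>*" if "u \<in> pverts ?H" "v \<in> pverts ?H" for u v
    using that by (meson rtrancl_trans)
  moreover have "pair_graph ?H"
    using assms unfolding connected_pair_graph_def pair_graph_iff
    by (auto simp: sym_def irrefl_def)
  ultimately show ?thesis
    using assms by (auto simp: connected_pair_graph_def)
qed

lemma card_parcs_attach_leaves:
  assumes "pair_graph G" "x \<in> pverts G" "finite S" "S \<inter> pverts G = {}"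
  shows "card (parcs (attach_leaves G x S)) = card (parcs G) + 2 * card S"
proof -
  interpret pair_graph G by fact
  have "card (parcs G \<union> {x} \<times> S \<union> S \<times> {x}) = card (parcs G \<union> {x} \<times> S) + card (S \<times> {x})"
    using assms pair_finite_arcs by (intro card_Un_disjoint) (auto dest: in_arcsD1 in_arcsD2)
  also have "card (parcs G \<union> {x} \<times> S) = card (parcs G) + card ({x} \<times> S)"
    using assms pair_finite_arcs by (intro card_Un_disjoint) (auto dest: in_arcsD1 in_arcsD2)
  finally show ?thesis
    by (simp add: card_cartesian_product)
qed

lemma expansions_attach_leaves:
  assumes "x \<in> pverts G" "finite S" "S \<inter> pverts G = {}"
  shows "expansion\<^sup>*\<^sup>* G (attach_leaves G x S)"
  using assms(2,3)
proof (induction S rule: finite_induct)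
  case (insert y S)
  let ?H = "attach_leaves G x S"
  have "expansion ?H \<lparr> pverts = pverts ?H \<union> {y}, parcs = parcs ?H \<union> {(x, y), (y, x)} \<rparr>"
    using insert assms(1) by (intro add_leaf) auto
  also have "\<lparr> pverts = pverts ?H \<union> {y}, parcs = parcs ?H \<union> {(x, y), (y, x)} \<rparr>
      = attach_leaves G x (insert y S)"
    by (auto simp: attach_leaves_def)
  finally show ?case
    using insert by (simp add: rtranclp.rtrancl_into_rtrancl)
qed simp

lemma collapses_attach_leaves:
  assumes "pair_graph G" "x \<in> pverts G" "finite S" "S \<inter> pverts G = {}"
  shows "collapse\<^sup>*\<^sup>* (attach_leaves G x S) G"
  using assms(3,4)
proof (induction S rule: finite_induct)
  case (insert y S)
  interpret pair_graph G by fact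
  let ?H = "attach_leaves G x (insert y S)"
  \<comment> \<open>As \<open>y\<close> lies outside \<open>G\<close> and outside \<open>S\<close>,
    its only outgoing arc leads to \<open>x\<close>. It is thus a leaf, and deleting it leaves the
    graph with leaves \<open>S\<close>.\<close>
  have y: "y \<notin> pverts G" "y \<noteq> x" "\<And>a. (a, y) \<notin> parcs G" "\<And>a. (y, a) \<notin> parcs G"
    using insert assms(2) in_arcsD1 in_arcsD2 by blast+
  then have "out_arcs (with_proj ?H) y = {(y, x)}"
    using insert by (auto simp: out_arcs_def)
  then have "collapse ?H \<lparr> pverts = pverts ?H - {y}, parcs = parcs ?H - {(x, y), (y, x)} \<rparr>"
    by (intro delete_leaf) (auto simp: out_degree_def)
  also have "\<lparr> pverts = pverts ?H - {y}, parcs = parcs ?H - {(x, y), (y, x)} \<rparr> = attach_leaves G x S"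
    using y insert by (auto simp: attach_leaves_def)
  finally show ?case
    using insert by (simp add: converse_rtranclp_into_rtranclp)
qed simp

text \<open>Slides never change the vertex set, so the isomorphisms of the final claim are absorbed
  into a renaming of one graph onto the vertices of the other. The graph
  \<open>with_fresh_vertices G\<close> is the instance for \<open>Inl\<close>.\<close>

definition map_graph :: "('a \<Rightarrow> 'b) \<Rightarrow> 'a pair_pre_digraph \<Rightarrow> 'b pair_pre_digraph" where
  "map_graph f G = \<lparr> pverts = f ` pverts G, parcs = map_prod f f ` parcs G \<rparr>"

lemma map_graph_simps [simp]:
  "pverts (map_graph f G) = f ` pverts G"
  "parcs (map_graph f G) = map_prod f f ` parcs G"
  by (simp_all add: map_graph_def)

lemma inj_on_map_prod_parcs:
  assumes "pair_graph G" "inj_on f (pverts G)"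
  shows "inj_on (map_prod f f) (parcs G)"
  using assms map_prod_inj_on[of f "pverts G" f "pverts G"]
  by (auto simp: pair_graph_iff intro: inj_on_subset)

lemma digraph_iso_map_graph:
  assumes "pair_graph G" "inj_on f (pverts G)"
  shows "digraph_iso (with_proj G) (with_proj (map_graph f G))"
proof -
  interpret pair_graph G by fact
  let ?h = "\<lparr> iso_verts = f, iso_arcs = map_prod f f, iso_head = snd, iso_tail = fst \<rparr>"
  have "digraph_isomorphism ?h"
    using assms wf_digraph inj_on_map_prod_parcs by (auto simp: digraph_isomorphism_def)
  moreover have "with_proj (map_graph f G) = app_iso ?h (with_proj G)"
    by (simp add: app_iso_def with_proj_def)
  ultimately show ?thesis
    by (auto simp: digraph_iso_def)
qed

lemma digraph_iso_map_graph':
  assumes "pair_graph G" "inj_on f (pverts G)"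
  shows "digraph_iso (with_proj (map_graph f G)) (with_proj G)"
proof -
  interpret pair_graph G by fact
  show ?thesis
    using wf_digraph digraph_iso_map_graph[OF assms] by (rule digraph_iso_swap)
qed

lemma map_graph_connected:
  assumes "connected_pair_graph G" "inj_on f (pverts G)"
  shows "connected_pair_graph (map_graph f G)"
proof -
  have "(f u, f v) \<in> (map_prod f f ` parcs G)\<^sup>*" if "(u, v) \<in> (parcs G)\<^sup>*" for u v
    using that
  proof (induction rule: rtrancl_induct)
    case (step v w)
    then have "(f v, f w) \<in> map_prod f f ` parcs G" by force
    with step.IH show ?case by (rule rtrancl_into_rtrancl)
  qed simp
  moreover have "pair_graph (map_graph f G)"
    using assms unfolding connected_pair_graph_def pair_graph_iff
    by (fastforce simp: sym_def irrefl_def dest: inj_onD)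
  ultimately show ?thesis
    using assms by (auto simp: connected_pair_graph_def)
qed

lemma card_map_graph:
  assumes "pair_graph G" "inj_on f (pverts G)"
  shows "card (pverts (map_graph f G)) = card (pverts G)"
    and "card (parcs (map_graph f G)) = card (parcs G)"
  using assms inj_on_map_prod_parcs[OF assms] by (simp_all add: card_image)

section \<open>Assembling the expanding and the collapsing sequence\<close>

theorem corollary5p1:
  fixes \<Gamma> :: "'a pair_pre_digraph" and \<Sigma> :: "'b pair_pre_digraph" and m n :: nat
  assumes "pair_graph \<Gamma>" and "connected (with_proj \<Gamma>)" and "card (pverts \<Gamma>) = m"
    and "pair_graph \<Sigma>" and "connected (with_proj \<Sigma>)" and "card (pverts \<Sigma>) = n"
    and "euler_char \<Gamma> = euler_char \<Sigma>"
    and "m \<le> n"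
  shows "(\<exists>\<Delta>. (\<lambda>G H. expansion G H \<or> edge_slide G H)\<^sup>*\<^sup>* (with_fresh_vertices \<Gamma>) \<Delta>
             \<and> digraph_iso (with_proj \<Delta>) (with_proj \<Sigma>))
       \<and> (\<exists>\<Delta>. (\<lambda>G H. collapse G H \<or> edge_slide G H)\<^sup>*\<^sup>* \<Sigma> \<Delta>
             \<and> digraph_iso (with_proj \<Delta>) (with_proj \<Gamma>))"
proof
  have cG: "connected_pair_graph \<Gamma>" and cS: "connected_pair_graph \<Sigma>"
    using assms by (auto intro: connected_pair_graphI)
  \<comment> \<open>Equal Euler characteristics make the edge numbers differ by
    \<open>n - m\<close>, exact in the naturals because \<open>m \<le> n\<close>. This is the number
    of edges that \<open>n - m\<close> leaves contribute.\<close>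
  have arcs: "card (parcs \<Sigma>) = card (parcs \<Gamma>) + 2 * (n - m)"
    using card_parcs[OF assms(1)] card_parcs[OF assms(4)] assms(3,6,7,8)
    by (simp add: euler_char_def)
  have fin: "finite (pverts \<Gamma>)" "finite (pverts \<Sigma>)"
    using assms(1,4) by (simp_all add: pair_graph_iff)
  obtain x where x: "x \<in> pverts \<Gamma>"
    using cG by (auto simp: connected_pair_graph_def)

  show "\<exists>\<Delta>. (\<lambda>G H. expansion G H \<or> edge_slide G H)\<^sup>*\<^sup>* (with_fresh_vertices \<Gamma>) \<Delta>
      \<and> digraph_iso (with_proj \<Delta>) (with_proj \<Sigma>)"
  proof -
    let ?G = "with_fresh_vertices \<Gamma>"
    have G: "?G = map_graph Inl \<Gamma>"
      by (simp add: with_fresh_vertices_def map_graph_def)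
    have connG: "connected_pair_graph ?G"
      unfolding G by (rule map_graph_connected[OF cG]) simp
    have cardG: "card (pverts ?G) = m" "card (parcs ?G) = card (parcs \<Gamma>)"
      unfolding G using card_map_graph[OF assms(1), of Inl] assms(3) by simp_all
    let ?S = "Inr ` {..<n - m} :: ('a + nat) set"
    let ?L = "attach_leaves ?G (Inl x) ?S"
    have S: "Inl x \<in> pverts ?G" "finite ?S" "?S \<inter> pverts ?G = {}" "card ?S = n - m"
      using x by (auto simp: G card_image)
    have connL: "connected_pair_graph ?L"
      using attach_leaves_connected[OF connG S(1,2,3)] .
    have cardL: "card (pverts ?L) = n" "card (parcs ?L) = card (parcs \<Sigma>)"
      using card_parcs_attach_leaves[OF _ S(1,2,3)] connG S cardG arcs fin(1) assms(8)
      by (auto simp: connected_pair_graph_def pair_graph_iff card_Un_disjoint Int_commute)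
    have finL: "finite (pverts ?L)"
      using connL by (simp add: connected_pair_graph_def pair_graph_iff)
    \<comment> \<open>Any bijection will do: slides connect all connected graphs with this vertex
      set and this number of edges, so adjacency can be ignored.\<close>
    obtain f where f: "bij_betw f (pverts \<Sigma>) (pverts ?L)"
      using finite_same_card_bij[OF fin(2) finL] cardL assms(6) by auto
    then have inj: "inj_on f (pverts \<Sigma>)" and im: "f ` pverts \<Sigma> = pverts ?L"
      by (auto simp: bij_betw_def)
    have slides: "edge_slide\<^sup>*\<^sup>* ?L (map_graph f \<Sigma>)"
      using connL map_graph_connected[OF cS inj]
    proof (rule edge_slides_between_connected)
      show "pverts ?L = pverts (map_graph f \<Sigma>)"
        using im by simp
      show "card (parcs ?L) = card (parcs (map_graph f \<Sigma>))"
        using cardL(2) card_map_graph(2)[OF assms(4) inj] by (rule trans[OF _ sym])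
    qed
    have "expansion\<^sup>*\<^sup>* ?G ?L"
      using expansions_attach_leaves[OF S(1,2,3)] .
    then have "(\<lambda>G H. expansion G H \<or> edge_slide G H)\<^sup>*\<^sup>* ?G (map_graph f \<Sigma>)"
      using slides by (rule rtranclp_trans_mono) auto
    then show ?thesis
      using digraph_iso_map_graph'[OF assms(4) inj] by blast
  qed

  show "\<exists>\<Delta>. (\<lambda>G H. collapse G H \<or> edge_slide G H)\<^sup>*\<^sup>* \<Sigma> \<Delta>
      \<and> digraph_iso (with_proj \<Delta>) (with_proj \<Gamma>)"
  proof -
    \<comment> \<open>Here the target copy of \<open>\<Gamma>\<close> is placed inside the vertex
      set of \<open>\<Sigma>\<close> by an arbitrary injection, and the remaining vertices of
      \<open>\<Sigma>\<close> become the leaves to be deleted.\<close>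
    obtain f where inj: "inj_on f (pverts \<Gamma>)" and im: "f ` pverts \<Gamma> \<subseteq> pverts \<Sigma>"
      using card_le_inj[OF fin] assms(3,6,8) by auto
    let ?G = "map_graph f \<Gamma>"
    let ?S = "pverts \<Sigma> - pverts ?G"
    let ?L = "attach_leaves ?G (f x) ?S"
    have connG: "connected_pair_graph ?G"
      using map_graph_connected[OF cG inj] .
    then have pgG: "pair_graph ?G"
      by (simp add: connected_pair_graph_def)
    have S: "f x \<in> pverts ?G" "finite ?S" "?S \<inter> pverts ?G = {}"
      using x fin by auto
    have "card ?S = n - m"
      using im fin inj assms(3,6) by (simp add: card_Diff_subset card_image)
    then have "card (parcs ?L) = card (parcs \<Sigma>)"
      using card_parcs_attach_leaves[OF pgG S] card_map_graph[OF assms(1) inj] arcs by simp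
    moreover have "pverts ?L = pverts \<Sigma>"
      using im by auto
    ultimately have slides: "edge_slide\<^sup>*\<^sup>* \<Sigma> ?L"
      using attach_leaves_connected[OF connG S] cS by (intro edge_slides_between_connected) auto
    have "collapse\<^sup>*\<^sup>* ?L ?G"
      using collapses_attach_leaves[OF pgG S] .
    with slides have "(\<lambda>G H. collapse G H \<or> edge_slide G H)\<^sup>*\<^sup>* \<Sigma> ?G"
      by (rule rtranclp_trans_mono) auto
    then show ?thesis
      using digraph_iso_map_graph'[OF assms(1) inj] by blast
  qed
qed

end
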